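(* Let $n\ge 2$ and let $m_1,\dots,m_n>0$ be masses in $\mathbb{H}^3$. Let $X\in\Delta_-$ be a singular configuration with $I_{-1}(X)=c>0$. Then there is a neighborhood of $X$ in $(\mathbb{H}^3)^n$ in which there is no ordinary central configuration for the masses $m_1,\dots,m_n$.
   Context: $\mathbb{R}^{3,1}$ is $\mathbb{R}^4$ with the bilinear form $\mathbf q_1\cdot\mathbf q_2=x_1x_2+y_1y_2+z_1z_2-w_1w_2$, where $\mathbf q_i=(x_i,y_i,z_i,w_i)$. $\mathbb{H}^3=\{(x,y,z,w)\in\mathbb{R}^{3,1}: x^2+y^2+z^2-w^2=-1,\ w\ge1\}$. The distance $d_{ij}$ between $\mathbf q_i,\mathbf q_j\in\mathbb{H}^3$ is given by $\cosh d_{ij}=-\mathbf q_i\cdot\mathbf q_j$. A configuration is $\mathbf q=(\mathbf q_1,\dots,\mathbf q_n)$, $\mathbf q_i\in\mathbb{H}^3$. The singular set is $\Delta_-=\bigcup_{i<j}\{\mathbf q\in(\mathbb{H}^3)^n:\mathbf q_i=\mathbf q_j\}$. The potential on $(\mathbb{H}^3)^n\setminus\Delta_-$ is $U_{-1}(\mathbf q)=\sum_{i<j}m_im_j\coth d_{ij}$, and the momentum of inertia on $(\mathbb{H}^3)^n$ is $I_{-1}(\mathbf q)=\sum_{i}m_i(x_i^2+y_i^2)$. An ordinary central configuration in $\mathbb{H}^3$ is a configuration $\mathbf q\in(\mathbb{H}^3)^n\setminus\Delta_-$ that is a critical point of $U_{-1}-\lambda I_{-1}$ for some $\lambda\in\mathbb{R}$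 (called the multiplier). *)

theory Defs
  imports "HOL-Analysis.Analysis"
begin

(* The coordinates x, y, z, w are the components 1, 2, 3, 4. *)
definition mink :: "real^4 \<Rightarrow> real^4 \<Rightarrow> real" (infixl "\<bullet>\<^sub>L" 70) where
  "p \<bullet>\<^sub>L q = p$1 * q$1 + p$2 * q$2 + p$3 * q$3 - p$4 * q$4"

definition H3 :: "(real^4) set" where
  "H3 = {q. (q$1)\<^sup>2 + (q$2)\<^sup>2 + (q$3)\<^sup>2 - (q$4)\<^sup>2 = -1 \<and> q$4 \<ge> 1}"

definition hdist :: "real^4 \<Rightarrow> real^4 \<Rightarrow> real" where
  "hdist p q = arcosh (- (p \<bullet>\<^sub>L q))"

lemma mink_le_minus_one:
  assumes "p \<in> H3" "q \<in> H3"
  shows "p \<bullet>\<^sub>L q \<le> -1"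
proof -
  define u v :: "real \<times> real \<times> real \<times> real"
    where "u = (p$1, p$2, p$3, 1)" and "v = (q$1, q$2, q$3, 1)"
  have p: "(p$1)\<^sup>2 + (p$2)\<^sup>2 + (p$3)\<^sup>2 + 1 = (p$4)\<^sup>2" "p$4 \<ge> 1"
    and q: "(q$1)\<^sup>2 + (q$2)\<^sup>2 + (q$3)\<^sup>2 + 1 = (q$4)\<^sup>2" "q$4 \<ge> 1"
    using assms by (auto simp: H3_def)
  have "norm u = p$4"
    using p by (simp add: u_def norm_eq_sqrt_inner power2_eq_square algebra_simps
        real_sqrt_unique)
  moreover have "norm v = q$4"
    using q by (simp add: v_def norm_eq_sqrt_inner power2_eq_square algebra_simps
        real_sqrt_unique)
  ultimately have "u \<bullet> v \<le> p$4 * q$4"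
    by (metis norm_cauchy_schwarz)
  then show ?thesis
    by (simp add: u_def v_def mink_def)
qed

lemma
  assumes "p \<in> H3" "q \<in> H3"
  shows cosh_hdist: "cosh (hdist p q) = - (p \<bullet>\<^sub>L q)"
    and hdist_nonneg: "hdist p q \<ge> 0"
  using mink_le_minus_one[OF assms]
  by (simp_all add: hdist_def)

definition coth :: "real \<Rightarrow> real" where
  "coth t = cosh t / sinh t"

(* A configuration of n bodies is an element of (real^4)^'n with n = CARD('n); the linear
   order on 'n serves only to write sums and unions over i < j. *)
definition configurations :: "((real^4)^'n) set" where
  "configurations = {q. \<forall>i. q$i \<in> H3}"

definition singular_set :: "((real^4)^('n::{finite,linorder})) set" where
  "singular_set = (\<Union>(i,j)\<in>{(i,j). i < j}. {q \<in> configurations. q$i = q$j})"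

definition potential :: "('n \<Rightarrow> real) \<Rightarrow> (real^4)^('n::{finite,linorder}) \<Rightarrow> real" where
  "potential m q = (\<Sum>(i,j)\<in>{(i,j). i < j}. m i * m j * coth (hdist (q$i) (q$j)))"

definition inertia :: "('n \<Rightarrow> real) \<Rightarrow> (real^4)^'n \<Rightarrow> real" where
  "inertia m q = (\<Sum>i\<in>UNIV. m i * ((q$i$1)\<^sup>2 + (q$i$2)\<^sup>2))"

(* Vanishing of the differential of f on the tangent space of the submanifold M at q, with
   tangent vectors represented as velocities at time 0 of differentiable curves in M. *)
definition critical_point :: "'a::real_normed_vector set \<Rightarrow> ('a \<Rightarrow> real) \<Rightarrow> 'a \<Rightarrow> bool" where
  "critical_point M f q \<longleftrightarrow> q \<in> M \<and>
     (\<forall>\<gamma> :: real \<Rightarrow> 'a. range \<gamma> \<subseteq> M \<and> (\<forall>t. \<gamma> differentiable (at t)) \<and> \<gamma> 0 = q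
        \<longrightarrow> ((\<lambda>t. f (\<gamma> t)) has_real_derivative 0) (at 0))"

definition ordinary_central_configuration ::
  "('n \<Rightarrow> real) \<Rightarrow> (real^4)^('n::{finite,linorder}) \<Rightarrow> bool" where
  "ordinary_central_configuration m q \<longleftrightarrow>
     (\<exists>\<mu>::real. critical_point (configurations - singular_set)
        (\<lambda>p. potential m p - \<mu> * inertia m p) q)"

end

theory Submission
  imports Defs
begin

text \<open>
  Write \<open>c\<^sub>i\<^sub>j = - (q\<^sub>i \<bullet>\<^sub>L q\<^sub>j) = cosh d\<^sub>i\<^sub>j\<close>, so that \<open>coth d\<^sub>i\<^sub>j = c\<^sub>i\<^sub>j / sqrt (c\<^sub>i\<^sub>j\<^sup>2 - 1)\<close>. A central
  configuration \<open>q\<close> with multiplier \<open>\<mu>\<close> satisfies, for every tangent vector \<open>v\<close>, an equation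
  \<open>dU (v) = \<mu> dI (v)\<close> (lemma \<open>first_variation\<close>). Two tangent vectors turn this into a contradiction
  near a collision \<open>X\<close>.

  The first is the gradient of \<open>\<Sum>i. cosh d(e\<^sub>4, q\<^sub>i)\<close>, which pushes all bodies away from the point
  \<open>e\<^sub>4 = (0,0,0,1)\<close>. It stretches every distance: the derivative of \<open>c\<^sub>i\<^sub>j\<close> is exactly
  \<open>(w\<^sub>i + w\<^sub>j) (c\<^sub>i\<^sub>j - 1)\<close>. The resulting identity \<open>dilation_identity\<close> has a sum of positive terms on
  one side, and the term of a colliding pair grows like \<open>1 / sqrt (c\<^sub>i\<^sub>j - 1)\<close>; on the other side
  stands \<open>\<mu>\<close> times a bounded quantity. Hence \<open>\<mu>\<close> would be unbounded near \<open>X\<close>.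

  The second keeps \<open>\<mu>\<close> bounded. As \<open>I(X) > 0\<close>, some body \<open>l\<close> of \<open>X\<close> is off the geodesic
  \<open>x = y = 0\<close>. Let \<open>C\<close> consist of all bodies that share the position of \<open>l\<close> in \<open>X\<close>, and let
  a Lorentz boost in the \<open>x,w\<close> or \<open>y,w\<close> plane act on \<open>C\<close> only. Being infinitesimally isometric, it
  does not feel the (possibly singular) forces inside \<open>C\<close>, and the forces between \<open>C\<close> and the other
  bodies stay bounded near \<open>X\<close>. So \<open>boost_identity\<close> reads \<open>A = \<mu> B\<close> with \<open>A\<close> and \<open>B\<close> continuous
  at \<open>X\<close> and \<open>B (X) \<noteq> 0\<close>. Eliminating \<open>\<mu>\<close> between the two identities avoids any passage to a
  sequence of multipliers.
\<close>

section \<open>The hyperboloid\<close>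

text \<open>The point is strictness for distinct points: \<open>(w\<^sub>p w\<^sub>q)\<^sup>2 - (1 + s\<^sub>p \<cdot> s\<^sub>q)\<^sup>2\<close>, with \<open>s\<close> the
  spatial parts, is \<open>|s\<^sub>p - s\<^sub>q|\<^sup>2\<close> plus a nonnegative Gram determinant.\<close>

lemma mink_less_minus_one:
  assumes p: "p \<in> H3" and q: "q \<in> H3" and "p \<noteq> q"
  shows "p \<bullet>\<^sub>L q < -1"
proof -
  have P: "(p$4)\<^sup>2 = 1 + (p$1)\<^sup>2 + (p$2)\<^sup>2 + (p$3)\<^sup>2" "p$4 \<ge> 1"
   and Q: "(q$4)\<^sup>2 = 1 + (q$1)\<^sup>2 + (q$2)\<^sup>2 + (q$3)\<^sup>2" "q$4 \<ge> 1"
    using p q by (auto simp: H3_def)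
  have "p$1 \<noteq> q$1 \<or> p$2 \<noteq> q$2 \<or> p$3 \<noteq> q$3"
  proof (rule ccontr)
    assume "\<not> ?thesis"
    moreover from this have "p$4 = q$4"
      using P Q by (metis dual_order.trans power2_eq_imp_eq zero_le_one)
    ultimately show False
      using \<open>p \<noteq> q\<close> by (simp add: vec_eq_iff forall_4)
  qed
  then have "0 < (p$1 - q$1)\<^sup>2 + (p$2 - q$2)\<^sup>2 + (p$3 - q$3)\<^sup>2"
    by (smt (verit) zero_less_power2 zero_le_power2)
  also have "\<dots> \<le> (p$1 - q$1)\<^sup>2 + (p$2 - q$2)\<^sup>2 + (p$3 - q$3)\<^sup>2
      + ((p$1 * q$2 - p$2 * q$1)\<^sup>2 + (p$1 * q$3 - p$3 * q$1)\<^sup>2 + (p$2 * q$3 - p$3 * q$2)\<^sup>2)"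
    by simp
  also have "\<dots> = (p$4)\<^sup>2 * (q$4)\<^sup>2 - (1 + (p$1 * q$1 + p$2 * q$2 + p$3 * q$3))\<^sup>2"
    unfolding P Q by (simp add: power2_eq_square algebra_simps)
  finally have "(1 + (p$1 * q$1 + p$2 * q$2 + p$3 * q$3))\<^sup>2 < (p$4 * q$4)\<^sup>2"
    by (simp add: power_mult_distrib)
  moreover have "0 \<le> p$4 * q$4"
    using P Q by simp
  ultimately have "1 + (p$1 * q$1 + p$2 * q$2 + p$3 * q$3) < p$4 * q$4"
    by (rule power2_less_imp_less)
  then show ?thesis
    by (simp add: mink_def)
qed

lemma mink_self: "p \<in> H3 \<Longrightarrow> p \<bullet>\<^sub>L p = -1"
  by (simp add: H3_def mink_def power2_eq_square)

lemma coth_hdist: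
  assumes "p \<in> H3" "q \<in> H3"
  shows "coth (hdist p q) = - (p \<bullet>\<^sub>L q) / sqrt ((- (p \<bullet>\<^sub>L q))\<^sup>2 - 1)"
proof -
  have "1 \<le> - (p \<bullet>\<^sub>L q)"
    using mink_le_minus_one[OF assms] by simp
  then show ?thesis
    unfolding coth_def cosh_hdist[OF assms] unfolding hdist_def by (subst sinh_arcosh_real) auto
qed

lemma coth_has_real_derivative:
  fixes c :: "real \<Rightarrow> real"
  assumes "(c has_real_derivative c') (at t)" and "c t > 1"
  shows "((\<lambda>t. c t / sqrt ((c t)\<^sup>2 - 1)) has_real_derivative - c' / (sqrt ((c t)\<^sup>2 - 1))^3) (at t)"
proof -
  have pos: "(c t)\<^sup>2 - 1 > 0"
    using assms(2) by (simp add: one_less_power)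
  define s where "s = sqrt ((c t)\<^sup>2 - 1)"
  have s: "s > 0" "s\<^sup>2 = (c t)\<^sup>2 - 1"
    using pos by (auto simp: s_def)
  have "((\<lambda>t. c t / sqrt ((c t)\<^sup>2 - 1)) has_real_derivative
      (c' * s - c t * (inverse s / 2 * (2 * c t * c'))) / (s * s)) (at t)"
    unfolding s_def using pos
    by (auto intro!: derivative_eq_intros assms(1) simp: power2_eq_square)
  also have "(c' * s - c t * (inverse s / 2 * (2 * c t * c'))) / (s * s) = c' * (s\<^sup>2 - (c t)\<^sup>2) / s^3"
    using s(1) by (simp add: field_simps power2_eq_square power3_eq_cube)
  also have "\<dots> = - c' / s^3"
    by (simp add: s(2))
  finally show ?thesis
    by (simp add: s_def)
qed

section \<open>The first variation at a central configuration\<close>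

lemma has_vector_derivative_componentwise:
  fixes f :: "real \<Rightarrow> 'a::real_normed_vector ^ 'n"
  assumes "\<And>i. ((\<lambda>t. f t $ i) has_vector_derivative D $ i) (at t)"
  shows "(f has_vector_derivative D) (at t)"
  unfolding has_vector_derivative_def has_derivative_at_within
proof (intro conjI vec_tendstoI)
  show "bounded_linear (\<lambda>x. x *\<^sub>R D)"
    by (rule bounded_linear_scaleR_left)
  fix i
  show "((\<lambda>y. ((f y - f t - (y - t) *\<^sub>R D) /\<^sub>R norm (y - t)) $ i) \<longlongrightarrow> 0 $ i) (at t)"
    using assms[of i] by (simp add: has_vector_derivative_def has_derivative_at_within)
qed

text \<open>\<open>H3\<close> is the graph of \<open>w = sqrt (1 + x\<^sup>2 + y\<^sup>2 + z\<^sup>2)\<close>, so a straight line in the spatial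
  coordinates lifts to a curve that stays in \<open>H3\<close> for all times.\<close>

definition graph_point :: "real^4 \<Rightarrow> real^4" where
  "graph_point p = (\<chi> k. if k = 4 then sqrt (1 + (p$1)\<^sup>2 + (p$2)\<^sup>2 + (p$3)\<^sup>2) else p$k)"

lemma graph_point_in_H3: "graph_point p \<in> H3"
  by (simp add: graph_point_def H3_def add_nonneg_nonneg)

lemma graph_point_H3_eq: "p \<in> H3 \<Longrightarrow> graph_point p = p"
  by (auto simp: graph_point_def H3_def vec_eq_iff intro!: real_sqrt_unique)

lemma graph_point_line_has_vector_derivative:
  defines "W \<equiv> \<lambda>p. sqrt (1 + (p$1)\<^sup>2 + (p$2)\<^sup>2 + (p$3)\<^sup>2)"
  shows "((\<lambda>t. graph_point (p + t *\<^sub>R u)) has_vector_derivative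
     (let r = p + t *\<^sub>R u in
      \<chi> k. if k = 4 then (r$1 * u$1 + r$2 * u$2 + r$3 * u$3) / W r else u$k)) (at t)"
proof (rule has_vector_derivative_componentwise)
  fix k :: 4
  have pos: "1 + (p$1 + t * u$1)\<^sup>2 + (p$2 + t * u$2)\<^sup>2 + (p$3 + t * u$3)\<^sup>2 > 0"
    by (intro add_pos_nonneg) auto
  show "((\<lambda>t. graph_point (p + t *\<^sub>R u) $ k) has_vector_derivative
     (let r = p + t *\<^sub>R u in
      \<chi> k. if k = 4 then (r$1 * u$1 + r$2 * u$2 + r$3 * u$3) / W r else u$k) $ k) (at t)"
    using pos
    by (auto simp: graph_point_def W_def Let_def has_real_derivative_iff_has_vector_derivative[symmetric]
        field_simps intro!: derivative_eq_intros)
qed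

lemma curve_through_tangent_vector:
  assumes q: "q \<in> configurations" and v: "\<And>i. q$i \<bullet>\<^sub>L v$i = 0"
  obtains \<beta> :: "real \<Rightarrow> (real^4)^'n"
  where "range \<beta> \<subseteq> configurations" "\<And>t. \<beta> differentiable (at t)" "\<beta> 0 = q"
    "(\<beta> has_vector_derivative v) (at 0)"
proof
  define \<beta> where "\<beta> t = (\<chi> i. graph_point (q$i + t *\<^sub>R v$i))" for t
  define \<beta>' where "\<beta>' t = (\<chi> i. let r = q$i + t *\<^sub>R v$i in
      \<chi> k. if k = 4 then (r$1 * v$i$1 + r$2 * v$i$2 + r$3 * v$i$3)
                    / sqrt (1 + (r$1)\<^sup>2 + (r$2)\<^sup>2 + (r$3)\<^sup>2) else v$i$k)" for t
  have der: "(\<beta> has_vector_derivative \<beta>' t) (at t)" for t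
    by (rule has_vector_derivative_componentwise)
       (simp add: \<beta>_def \<beta>'_def graph_point_line_has_vector_derivative)
  show "range \<beta> \<subseteq> configurations"
    by (auto simp: \<beta>_def configurations_def graph_point_in_H3)
  show "\<beta> differentiable (at t)" for t
    using der by (rule differentiableI_vector)
  show "\<beta> 0 = q"
    using q by (simp add: \<beta>_def configurations_def graph_point_H3_eq vec_eq_iff[of _ q])
  have "\<beta>' 0 $ i $ k = v $ i $ k" for i k
  proof (cases "k = 4")
    case True
    have "q$i \<in> H3"
      using q by (simp add: configurations_def)
    then have "sqrt (1 + (q$i$1)\<^sup>2 + (q$i$2)\<^sup>2 + (q$i$3)\<^sup>2) = q$i$4" "q$i$4 \<noteq> 0"
      by (auto simp: H3_def intro!: real_sqrt_unique)
    then show ?thesis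
      using True v[of i] by (simp add: \<beta>'_def Let_def mink_def field_simps)
  qed (simp add: \<beta>'_def Let_def)
  then have "\<beta>' 0 = v"
    by (simp add: vec_eq_iff)
  then show "(\<beta> has_vector_derivative v) (at 0)"
    using der[of 0] by simp
qed

lemma nonsingular_distinct:
  fixes q :: "(real^4)^'n::{finite,linorder}"
  assumes "q \<in> configurations - singular_set" "i \<noteq> j"
  shows "q$i \<noteq> q$j"
proof (cases "i < j")
  case True
  then show ?thesis
    using assms(1) unfolding singular_set_def by auto
next
  case False
  then have "j < i"
    using assms(2) by simp
  then have "q$j \<noteq> q$i"
    using assms(1) unfolding singular_set_def by auto
  then show ?thesis
    by metis
qed

text \<open>A test curve of a critical point must avoid the singular set at all times. Running along
  \<open>\<beta>\<close> at parameter \<open>\<delta> sin t\<close> achieves this for small \<open>\<delta>\<close> and only rescales the velocity at 0.\<close>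

lemma critical_point_derivative_along_curve:
  fixes \<beta> :: "real \<Rightarrow> (real^4)^'n::{finite,linorder}"
  assumes crit: "critical_point (configurations - singular_set) f q"
    and \<beta>: "range \<beta> \<subseteq> configurations" "\<And>t. \<beta> differentiable (at t)" "\<beta> 0 = q"
    and D: "((\<lambda>t. f (\<beta> t)) has_real_derivative D) (at 0)"
  shows "D = 0"
proof -
  have q: "q \<in> configurations - singular_set"
    using crit by (simp add: critical_point_def)
  have "isCont \<beta> 0"
    using \<beta>(2) by (simp add: differentiable_imp_continuous_within)
  then have "(\<beta> \<longlongrightarrow> \<beta> 0) (nhds 0)"
    by (simp only: isCont_def tendsto_at_iff_tendsto_nhds)
  then have lim: "(\<beta> \<longlongrightarrow> q) (nhds 0)"
    by (simp only: \<beta>(3))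
  have "\<forall>\<^sub>F t in nhds 0. \<beta> t $ i \<noteq> \<beta> t $ j" if "i \<noteq> j" for i j
  proof -
    have "((\<lambda>t. \<beta> t $ i - \<beta> t $ j) \<longlongrightarrow> q $ i - q $ j) (nhds 0)"
      by (intro tendsto_intros lim)
    moreover have "q $ i - q $ j \<noteq> 0"
      using nonsingular_distinct[OF q that] by simp
    ultimately have "\<forall>\<^sub>F t in nhds 0. \<beta> t $ i - \<beta> t $ j \<noteq> 0"
      by (rule tendsto_imp_eventually_ne)
    then show ?thesis
      by simp
  qed
  then have "\<forall>\<^sub>F t in nhds 0. i < j \<longrightarrow> \<beta> t $ i \<noteq> \<beta> t $ j" for i j
    by (cases "i < j") auto
  then have "\<forall>\<^sub>F t in nhds 0. \<forall>i j. i < j \<longrightarrow> \<beta> t $ i \<noteq> \<beta> t $ j"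
    by (intro eventually_all_finite)
  then obtain e where e: "e > 0" "\<And>t i j. \<bar>t\<bar> < e \<Longrightarrow> i < j \<Longrightarrow> \<beta> t $ i \<noteq> \<beta> t $ j"
    unfolding eventually_nhds_metric by (auto simp: dist_real_def)
  define \<delta> where "\<delta> = e / 2"
  have \<delta>: "\<delta> > 0" "\<delta> < e"
    using e(1) by (auto simp: \<delta>_def)
  define \<gamma> where "\<gamma> t = \<beta> (\<delta> * sin t)" for t
  have small: "\<bar>\<delta> * sin t\<bar> < e" for t
  proof -
    have "\<bar>\<delta> * sin t\<bar> = \<delta> * \<bar>sin t\<bar>"
      using \<delta>(1) by (simp add: abs_mult)
    also have "\<dots> \<le> \<delta> * 1"
      using \<delta>(1) by (intro mult_left_mono) auto
    finally show ?thesis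
      using \<delta>(2) by simp
  qed
  have "range \<gamma> \<subseteq> configurations - singular_set"
    using \<beta>(1) e(2)[OF small] by (fastforce simp: \<gamma>_def singular_set_def)
  moreover have "\<gamma> differentiable (at t)" for t
  proof -
    have "(\<lambda>t::real. \<delta> * sin t) differentiable (at t)"
      by (rule differentiableI_vector[of _ "\<delta> * cos t"])
         (auto simp flip: has_real_derivative_iff_has_vector_derivative intro!: derivative_eq_intros)
    then have "(\<beta> \<circ> (\<lambda>t. \<delta> * sin t)) differentiable (at t)"
      by (rule differentiable_chain_at) (rule \<beta>(2))
    then show ?thesis
      by (simp add: \<gamma>_def[abs_def] o_def)
  qed
  moreover have "\<gamma> 0 = q"
    by (simp add: \<gamma>_def \<beta>(3))
  ultimately have "((\<lambda>t. f (\<gamma> t)) has_real_derivative 0) (at 0)"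
    using crit by (auto simp: critical_point_def)
  moreover have "((\<lambda>t. f (\<gamma> t)) has_real_derivative D * \<delta>) (at 0)"
  proof -
    have "((\<lambda>t. \<delta> * sin t) has_real_derivative \<delta>) (at 0)"
      by (auto intro!: derivative_eq_intros)
    then show ?thesis
      using DERIV_chain2[of "\<lambda>t. f (\<beta> t)" D "\<lambda>t. \<delta> * sin t" 0] D by (simp add: \<gamma>_def)
  qed
  ultimately have "D * \<delta> = 0"
    by (rule DERIV_unique[symmetric])
  then show ?thesis
    using \<delta> by simp
qed

text \<open>Away from collisions the summand of \<open>coth d\<^sub>i\<^sub>j\<close> has derivative
  \<open>- c' / sqrt (c\<^sub>i\<^sub>j\<^sup>2 - 1)^3\<close>, where \<open>c' = - (v\<^sub>i \<bullet>\<^sub>L q\<^sub>j + q\<^sub>i \<bullet>\<^sub>L v\<^sub>j)\<close>.\<close>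

lemma first_variation:
  fixes q v :: "(real^4)^'n::{finite,linorder}"
  assumes crit: "critical_point (configurations - singular_set)
        (\<lambda>p. potential m p - \<mu> * inertia m p) q"
    and v: "\<And>i. q$i \<bullet>\<^sub>L v$i = 0"
  shows "(\<Sum>(i,j)\<in>{(i,j). i < j}. m i * m j *
            ((v$i \<bullet>\<^sub>L q$j + q$i \<bullet>\<^sub>L v$j) / (sqrt ((- (q$i \<bullet>\<^sub>L q$j))\<^sup>2 - 1))^3))
       = \<mu> * (\<Sum>i\<in>UNIV. m i * (2 * (q$i$1 * v$i$1 + q$i$2 * v$i$2)))"
    (is "?U = \<mu> * ?I")
proof -
  have q: "q \<in> configurations - singular_set"
    using crit by (simp add: critical_point_def)
  obtain \<beta>
    where \<beta>: "range \<beta> \<subseteq> configurations" "\<And>t. \<beta> differentiable (at t)" "\<beta> 0 = q"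
      and \<beta>': "(\<beta> has_vector_derivative v) (at 0)"
    using curve_through_tangent_vector[of q v] q v by blast
  have comp: "((\<lambda>t. \<beta> t $ i $ k) has_real_derivative v$i$k) (at 0)" for i k
    unfolding has_real_derivative_iff_has_vector_derivative
    by (intro bounded_linear.has_vector_derivative[OF bounded_linear_vec_nth] \<beta>')
  have H: "\<beta> t $ i \<in> H3" for t i
    using \<beta>(1) by (auto simp: configurations_def)
  have mink': "((\<lambda>t. - (\<beta> t $ i \<bullet>\<^sub>L \<beta> t $ j)) has_real_derivative
      - (v$i \<bullet>\<^sub>L q$j + q$i \<bullet>\<^sub>L v$j)) (at 0)" for i j
    unfolding mink_def using \<beta>(3)
    by (auto intro!: derivative_eq_intros comp simp: algebra_simps)
  have "((\<lambda>t. coth (hdist (\<beta> t $ i) (\<beta> t $ j))) has_real_derivative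
      (v$i \<bullet>\<^sub>L q$j + q$i \<bullet>\<^sub>L v$j) / (sqrt ((- (q$i \<bullet>\<^sub>L q$j))\<^sup>2 - 1))^3) (at 0)"
    if "i < j" for i j
  proof -
    have "q$i \<bullet>\<^sub>L q$j < -1"
      using q that nonsingular_distinct[OF q, of i j]
      by (intro mink_less_minus_one) (auto simp: configurations_def)
    then show ?thesis
      using coth_has_real_derivative[OF mink', of i j] \<beta>(3) by (simp add: coth_hdist H add.commute)
  qed
  then have "((\<lambda>t. potential m (\<beta> t)) has_real_derivative ?U) (at 0)"
    unfolding potential_def by (intro DERIV_sum) (auto intro!: DERIV_cmult simp del: times_divide_eq_right)
  moreover have "((\<lambda>t. inertia m (\<beta> t)) has_real_derivative ?I) (at 0)"
  proof -
    have "((\<lambda>t. m i * ((\<beta> t$i$1)\<^sup>2 + (\<beta> t$i$2)\<^sup>2)) has_real_derivative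
        m i * (2 * (q$i$1 * v$i$1 + q$i$2 * v$i$2))) (at 0)" for i
      using \<beta>(3) by (auto intro!: derivative_eq_intros comp simp: algebra_simps)
    then show ?thesis
      unfolding inertia_def by (intro DERIV_sum) auto
  qed
  ultimately have "((\<lambda>t. potential m (\<beta> t) - \<mu> * inertia m (\<beta> t)) has_real_derivative
      ?U - \<mu> * ?I) (at 0)"
    by (intro DERIV_diff DERIV_cmult)
  then have "?U - \<mu> * ?I = 0"
    by (rule critical_point_derivative_along_curve[OF crit \<beta>])
  then show ?thesis
    by simp
qed

section \<open>Two test motions\<close>

lemma mink_simps:
  "(p + q) \<bullet>\<^sub>L r = p \<bullet>\<^sub>L r + q \<bullet>\<^sub>L r" "p \<bullet>\<^sub>L (q + r) = p \<bullet>\<^sub>L q + p \<bullet>\<^sub>L r"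
  "(p - q) \<bullet>\<^sub>L r = p \<bullet>\<^sub>L r - q \<bullet>\<^sub>L r" "p \<bullet>\<^sub>L (q - r) = p \<bullet>\<^sub>L q - p \<bullet>\<^sub>L r"
  "(a *\<^sub>R p) \<bullet>\<^sub>L q = a * (p \<bullet>\<^sub>L q)" "p \<bullet>\<^sub>L (a *\<^sub>R q) = a * (p \<bullet>\<^sub>L q)"
  "0 \<bullet>\<^sub>L p = 0" "p \<bullet>\<^sub>L 0 = 0"
  "p \<bullet>\<^sub>L axis 4 1 = - p$4" "axis 4 1 \<bullet>\<^sub>L p = - p$4"
  by (auto simp: mink_def axis_def algebra_simps)

lemma mink_spatial_axis: "k \<noteq> 4 \<Longrightarrow> p \<bullet>\<^sub>L axis k 1 = p$k \<and> axis k 1 \<bullet>\<^sub>L p = p$k"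
  using exhaust_4[of k] by (auto simp: mink_def axis_def)

text \<open>The tangent vector is \<open>w\<^sub>i q\<^sub>i - e\<^sub>4\<close>, the projection of \<open>- e\<^sub>4\<close> to the tangent space at
  \<open>q\<^sub>i\<close>.\<close>

lemma dilation_identity:
  fixes q :: "(real^4)^'n::{finite,linorder}"
  assumes crit: "critical_point (configurations - singular_set)
        (\<lambda>p. potential m p - \<mu> * inertia m p) q"
  shows "(\<Sum>(i,j)\<in>{(i,j). i < j}. m i * m j * ((q$i$4 + q$j$4) *
            ((- (q$i \<bullet>\<^sub>L q$j) - 1) / (sqrt ((- (q$i \<bullet>\<^sub>L q$j))\<^sup>2 - 1))^3)))
       = - \<mu> * (\<Sum>i\<in>UNIV. m i * (2 * q$i$4 * ((q$i$1)\<^sup>2 + (q$i$2)\<^sup>2)))"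
    (is "?S = - \<mu> * ?D")
proof -
  define v where "v = (\<chi> i. q$i$4 *\<^sub>R q$i - axis 4 (1::real))"
  have H: "q$i \<in> H3" for i
    using crit by (auto simp: critical_point_def configurations_def)
  have "q$i \<bullet>\<^sub>L v$i = 0" for i
    by (simp add: v_def mink_simps mink_self[OF H])
  note fv = first_variation[OF crit this]
  have "v$i \<bullet>\<^sub>L q$j + q$i \<bullet>\<^sub>L v$j = - ((q$i$4 + q$j$4) * (- (q$i \<bullet>\<^sub>L q$j) - 1))" for i j
    by (simp add: v_def mink_simps algebra_simps)
  then have "- ?S = (\<Sum>(i,j)\<in>{(i,j). i < j}. m i * m j *
            ((v$i \<bullet>\<^sub>L q$j + q$i \<bullet>\<^sub>L v$j) / (sqrt ((- (q$i \<bullet>\<^sub>L q$j))\<^sup>2 - 1))^3))"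
    by (simp add: sum_negf[symmetric] case_prod_unfold)
  also have "\<dots> = \<mu> * ?D"
    unfolding fv by (simp add: v_def axis_def power2_eq_square algebra_simps)
  finally show ?thesis
    by simp
qed

text \<open>The infinitesimal Lorentz boost in the plane of the coordinates \<open>k\<close> and \<open>w\<close>, applied to the
  bodies in \<open>C\<close> while the others rest.\<close>

definition cluster_boost :: "'n set \<Rightarrow> 4 \<Rightarrow> (real^4)^'n \<Rightarrow> (real^4)^'n" where
  "cluster_boost C k q = (\<chi> i. if i \<in> C then q$i$4 *\<^sub>R axis k 1 + q$i$k *\<^sub>R axis 4 1 else 0)"

text \<open>Pairs inside or outside \<open>C\<close> drop out since the boost preserves \<open>\<bullet>\<^sub>L\<close>; setting their terms to
  0 explicitly makes the left-hand side continuous at collisions inside \<open>C\<close> or outside \<open>C\<close>.\<close>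

lemma boost_identity:
  fixes q :: "(real^4)^'n::{finite,linorder}" and C :: "'n set" and k :: 4
  assumes crit: "critical_point (configurations - singular_set)
        (\<lambda>p. potential m p - \<mu> * inertia m p) q"
    and k: "k = 1 \<or> k = 2"
  defines "v \<equiv> cluster_boost C k q"
  shows "(\<Sum>(i,j)\<in>{(i,j). i < j}. if i \<in> C \<longleftrightarrow> j \<in> C then 0 else m i * m j *
            ((v$i \<bullet>\<^sub>L q$j + q$i \<bullet>\<^sub>L v$j) / (sqrt ((- (q$i \<bullet>\<^sub>L q$j))\<^sup>2 - 1))^3))
       = \<mu> * (\<Sum>i\<in>C. m i * (2 * (q$i$k * q$i$4)))"
    (is "?A = \<mu> * ?B")
proof -
  have k4: "k \<noteq> 4"
    using k by auto
  note simps = mink_simps mink_spatial_axis[OF k4]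
  have "q$i \<bullet>\<^sub>L v$i = 0" for i
    by (simp add: v_def cluster_boost_def simps)
  note fv = first_variation[OF crit this]
  have "v$i \<bullet>\<^sub>L q$j + q$i \<bullet>\<^sub>L v$j = 0" if "i \<in> C \<longleftrightarrow> j \<in> C" for i j
    using that by (auto simp: v_def cluster_boost_def simps)
  then have "?A = (\<Sum>(i,j)\<in>{(i,j). i < j}. m i * m j *
            ((v$i \<bullet>\<^sub>L q$j + q$i \<bullet>\<^sub>L v$j) / (sqrt ((- (q$i \<bullet>\<^sub>L q$j))\<^sup>2 - 1))^3))"
    by (intro sum.cong) auto
  also have "\<dots> = \<mu> * (\<Sum>i\<in>UNIV. m i * (2 * (q$i$1 * v$i$1 + q$i$2 * v$i$2)))"
    by (rule fv)
  also have "(\<Sum>i\<in>UNIV. m i * (2 * (q$i$1 * v$i$1 + q$i$2 * v$i$2))) = ?B"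
    by (rule sum.mono_neutral_cong_right)
       (use k in \<open>auto simp: v_def cluster_boost_def axis_def\<close>)
  finally show ?thesis .
qed

section \<open>No central configurations near a collision\<close>

lemma isCont_mink:
  assumes "isCont f x" "isCont g x"
  shows "isCont (\<lambda>x. f x \<bullet>\<^sub>L g x) x"
  unfolding mink_def using assms by (intro continuous_intros isCont_vec_nth)

lemma pair_blowup:
  fixes c :: real
  assumes "c > 1"
  shows "(c - 1) / (sqrt (c\<^sup>2 - 1))^3 * sqrt (c - 1) = 1 / (sqrt (c + 1))^3"
proof -
  define s where "s = sqrt (c - 1)"
  have s: "s > 0" "c - 1 = s\<^sup>2"
    using assms by (auto simp: s_def)
  have "sqrt (c\<^sup>2 - 1) = s * sqrt (c + 1)"
    by (simp add: s_def flip: real_sqrt_mult) (simp add: power2_eq_square algebra_simps)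
  then show ?thesis
    using s assms
    by (simp add: power_mult_distrib power2_eq_square power3_eq_cube flip: s_def)
qed

text \<open>For a central configuration the two identities \<open>A = \<mu> B\<close> and \<open>S = - \<mu> D\<close> give
  \<open>S |B| = |A D|\<close>. Keeping from \<open>S\<close> only the term of a pair \<open>a, b\<close> that collides in
  \<open>X\<close> and multiplying by \<open>sqrt (- (q\<^sub>a \<bullet>\<^sub>L q\<^sub>b) - 1)\<close> to remove its singularity yields \<open>h \<le> |g|\<close> with \<open>g\<close> and \<open>h\<close> continuous at
  \<open>X\<close>, where \<open>g (X) = 0 < h (X)\<close>.\<close>

theorem theorem5:
  fixes m :: "'n::{finite,linorder} \<Rightarrow> real" and X :: "(real^4)^('n::{finite,linorder})" and c :: real
  assumes "CARD('n) \<ge> 2"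
    and "\<And>i. m i > 0"
    and "X \<in> singular_set"
    and "inertia m X = c" and "c > 0"
  shows "\<exists>N. openin (top_of_set configurations) N \<and> X \<in> N \<and>
           (\<forall>q\<in>N. \<not> ordinary_central_configuration m q)"
proof -
  have m: "m i > 0" for i
    by (rule assms(2))
  obtain a b where ab: "a < b" "X$a = X$b" and X: "X \<in> configurations"
    using assms(3) by (auto simp: singular_set_def)
  have XH: "X$i \<in> H3" for i
    using X by (simp add: configurations_def)
  have Xw: "X$i$4 \<ge> 1" for i
    using XH[of i] by (simp add: H3_def)
  obtain l where "(X$l$1)\<^sup>2 + (X$l$2)\<^sup>2 \<noteq> 0"
  proof (rule ccontr)
    assume "\<not> thesis"
    then have "(X$i$1)\<^sup>2 + (X$i$2)\<^sup>2 = 0" for i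
      using that by blast
    then have "inertia m X = 0"
      by (simp only: inertia_def mult_zero_right sum.neutral_const)
    with assms show False
      by simp
  qed
  then obtain k :: 4 where k: "k = 1 \<or> k = 2" "X$l$k \<noteq> 0"
    by fastforce
  define C where "C = {i. X$i = X$l}"
  define A where "A q = (\<Sum>(i,j)\<in>{(i,j). i < j}. if i \<in> C \<longleftrightarrow> j \<in> C then 0 else m i * m j *
            ((cluster_boost C k q$i \<bullet>\<^sub>L q$j + q$i \<bullet>\<^sub>L cluster_boost C k q$j)
              / (sqrt ((- (q$i \<bullet>\<^sub>L q$j))\<^sup>2 - 1))^3))" for q
  define B where "B q = (\<Sum>i\<in>C. m i * (2 * (q$i$k * q$i$4)))" for q
  define D where "D q = (\<Sum>i\<in>UNIV. m i * (2 * q$i$4 * ((q$i$1)\<^sup>2 + (q$i$2)\<^sup>2)))"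
    for q :: "(real^4)^'n::{finite,linorder}"
  define g where "g q = A q * D q * sqrt (- (q$a \<bullet>\<^sub>L q$b) - 1)" for q
  define h where "h q = \<bar>B q\<bar> * (m a * m b * ((q$a$4 + q$b$4) *
      (1 / (sqrt (- (q$a \<bullet>\<^sub>L q$b) + 1))^3)))" for q

  have contq: "isCont (\<lambda>q. q$i) X" and contc: "isCont (\<lambda>q. q$i$r) X" for i r
    by (intro continuous_intros isCont_vec_nth)+
  have contm: "isCont (\<lambda>q. q$i \<bullet>\<^sub>L q$j) X" for i j
    by (intro isCont_mink contq)
  have contA: "isCont A X"
  proof -
    have boost: "isCont (\<lambda>q. cluster_boost C k q $ i) X" for i
      by (cases "i \<in> C") (auto simp: cluster_boost_def intro!: continuous_intros contc)
    have "isCont (\<lambda>q. if i \<in> C \<longleftrightarrow> j \<in> C then 0 else m i * m j *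
            ((cluster_boost C k q$i \<bullet>\<^sub>L q$j + q$i \<bullet>\<^sub>L cluster_boost C k q$j)
              / (sqrt ((- (q$i \<bullet>\<^sub>L q$j))\<^sup>2 - 1))^3)) X" for i j
    proof (cases "i \<in> C \<longleftrightarrow> j \<in> C")
      case False
      then have "X$i \<noteq> X$j"
        by (auto simp: C_def)
      then have "X$i \<bullet>\<^sub>L X$j < -1"
        by (intro mink_less_minus_one XH)
      then have "(- (X$i \<bullet>\<^sub>L X$j))\<^sup>2 > 1"
        by (intro one_less_power) auto
      then have "(sqrt ((- (X$i \<bullet>\<^sub>L X$j))\<^sup>2 - 1))^3 \<noteq> 0"
        by simp
      then have "isCont (\<lambda>q. m i * m j *
            ((cluster_boost C k q$i \<bullet>\<^sub>L q$j + q$i \<bullet>\<^sub>L cluster_boost C k q$j)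
              / (sqrt ((- (q$i \<bullet>\<^sub>L q$j))\<^sup>2 - 1))^3)) X"
        by (intro continuous_intros isCont_mink contq boost)
      then show ?thesis
        using False by simp
    qed simp
    then show ?thesis
      unfolding A_def by (intro continuous_sum) (auto simp: case_prod_unfold)
  qed
  have contB: "isCont B X"
    unfolding B_def by (intro continuous_intros contc)
  have contD: "isCont D X"
    unfolding D_def by (intro continuous_intros contc)

  have Xab: "X$a \<bullet>\<^sub>L X$b = -1"
    using mink_self[OF XH] ab(2) by metis
  have contg: "isCont g X"
    unfolding g_def by (intro continuous_intros contA contD contm)
  have conth: "isCont h X"
    unfolding h_def using Xab by (intro continuous_intros contB contc contm) auto
  have "B X \<noteq> 0"
  proof -
    have "B X = X$l$k * (\<Sum>i\<in>C. m i * (2 * X$i$4))"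
      unfolding B_def sum_distrib_left by (rule sum.cong) (auto simp: C_def)
    moreover have "(\<Sum>i\<in>C. m i * (2 * X$i$4)) > 0"
    proof (rule sum_pos)
      show "C \<noteq> {}"
        by (auto simp: C_def)
      show "m i * (2 * X$i$4) > 0" for i
        using m Xw[of i] by simp
    qed simp
    ultimately show ?thesis
      using k(2) by simp
  qed
  then have "h X > 0"
    using m Xw[of a] Xw[of b] by (simp add: h_def Xab)
  then have "h X - \<bar>g X\<bar> > 0"
    by (simp add: g_def Xab)
  moreover have "((\<lambda>q. h q - \<bar>g q\<bar>) \<longlongrightarrow> h X - \<bar>g X\<bar>) (nhds X)"
    using contg conth by (intro tendsto_intros) (simp_all add: isCont_def tendsto_at_iff_tendsto_nhds)
  ultimately have "\<forall>\<^sub>F q in nhds X. h q - \<bar>g q\<bar> > 0"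
    by (intro order_tendstoD(1)[of _ "h X - \<bar>g X\<bar>"])
  then obtain V where V: "open V" "X \<in> V" "\<And>q. q \<in> V \<Longrightarrow> \<bar>g q\<bar> < h q"
    unfolding eventually_nhds by auto

  have cc: "h q \<le> \<bar>g q\<bar>" if "ordinary_central_configuration m q" for q
  proof -
    obtain \<mu> where crit: "critical_point (configurations - singular_set)
        (\<lambda>p. potential m p - \<mu> * inertia m p) q"
      using \<open>ordinary_central_configuration m q\<close> by (auto simp: ordinary_central_configuration_def)
    then have q: "q \<in> configurations - singular_set"
      by (simp add: critical_point_def)
    then have H: "q$i \<in> H3" for i
      by (auto simp: configurations_def)
    define T where "T i j = m i * m j * ((q$i$4 + q$j$4) *
            ((- (q$i \<bullet>\<^sub>L q$j) - 1) / (sqrt ((- (q$i \<bullet>\<^sub>L q$j))\<^sup>2 - 1))^3))" for i j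
    define S where "S = (\<Sum>(i,j)\<in>{(i,j). i < j}. T i j)"
    have AB: "A q = \<mu> * B q"
      unfolding A_def B_def by (rule boost_identity[OF crit k(1)])
    have SD: "S = - \<mu> * D q"
      unfolding S_def T_def D_def by (rule dilation_identity[OF crit])
    have T_nonneg: "T i j \<ge> 0" for i j
    proof -
      have "- (q$i \<bullet>\<^sub>L q$j) \<ge> 1"
        using mink_le_minus_one[OF H H, of i j] by simp
      moreover from this have "(- (q$i \<bullet>\<^sub>L q$j))\<^sup>2 \<ge> 1"
        by (rule one_le_power)
      moreover have "q$i$4 + q$j$4 \<ge> 0"
        using H[of i] H[of j] by (auto simp: H3_def)
      ultimately show ?thesis
        using m[of i] m[of j] by (simp add: T_def)
    qed
    have "(\<Sum>(i,j)\<in>{(a,b)}. T i j) \<le> S"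
      unfolding S_def using ab(1) T_nonneg by (intro sum_mono2) auto
    then have "T a b \<le> S"
      by simp
    define s where "s = sqrt (- (q$a \<bullet>\<^sub>L q$b) - 1)"
    have ab1: "- (q$a \<bullet>\<^sub>L q$b) > 1"
      using mink_less_minus_one[OF H H, of a b] nonsingular_distinct[OF q, of a b] ab(1) by auto
    then have "s \<ge> 0"
      by (simp add: s_def)
    have "h q = \<bar>B q\<bar> * (T a b * s)"
      unfolding h_def T_def s_def pair_blowup[OF ab1, symmetric] by (simp only: mult.assoc)
    also have "\<dots> \<le> \<bar>B q\<bar> * (S * s)"
      using \<open>T a b \<le> S\<close> \<open>s \<ge> 0\<close> by (intro mult_left_mono mult_right_mono) auto
    also have "\<dots> \<le> \<bar>B q\<bar> * \<bar>S * s\<bar>"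
      by (intro mult_left_mono abs_ge_self abs_ge_zero)
    also have "\<dots> = \<bar>B q * (S * s)\<bar>"
      by (rule abs_mult[symmetric])
    also have "B q * (S * s) = - g q"
      unfolding SD g_def AB s_def by (simp only: mult_ac mult_minus_left mult_minus_right)
    finally show ?thesis
      by simp
  qed
  show ?thesis
  proof (intro exI conjI ballI)
    show "openin (top_of_set configurations) (configurations \<inter> V)"
      using V(1) by (rule openin_open_Int)
    show "X \<in> configurations \<inter> V"
      using X V(2) by simp
    show "\<not> ordinary_central_configuration m q" if "q \<in> configurations \<inter> V" for q
      using that V(3)[of q] cc[of q] by (meson IntD2 not_less)
  qed
qed

end
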